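(* Let $f \in P(\mathbb{R})$, and for $r>0$ let $f_r(x) = r^{-1} f(x/r)$. Let $\phi \in L^{\infty}(\mathbb{R})$ (complex-valued) and let $\alpha \in \mathbb{C}$. Then $\phi$ is almost convergent to $\alpha$ if and only if $$\lim_{r \to \infty} (f_r * \phi)(x) = \alpha$$ uniformly in $x \in \mathbb{R}$; in other words, if and only if $\lim_{r \to \infty} \|f_r * \phi - \alpha\|_{\infty} = 0$.
   Context: $L^{\infty}(\mathbb{R})$ is the space of (complex-valued) essentially bounded measurable functions on $\mathbb{R}$. $P(\mathbb{R})$ is the set of $f \in L^1(\mathbb{R})$ with $f \ge 0$ and $\int_{\mathbb{R}} f(x)\,dx = 1$. Convolution: $(f*\phi)(x) = \int_{\mathbb{R}} \phi(x-t) f(t)\,dt$. A mean on $L^{\infty}(\mathbb{R})$ is an element $\Phi$ of the dual space $L^{\infty}(\mathbb{R})^*$ such that $\Phi(\phi) \ge 0$ whenever $\phi \ge 0$, and $\Phi(1) = 1$. A mean $\Phi$ is topologically invariant if $\Phi(g * \phi) = \Phi(\phi)$ for every $g \in P(\mathbb{R})$ and $\phi \in L^{\infty}(\mathbb{R})$. $\mathcal{T}(\mathbb{R})$ is the set of topologically invariant means. A function $\phi \in L^{\infty}(\mathbb{R})$ is almost convergent to $\alpha \in \mathbb{C}$ if $\Phi(\phi) = \alpha$ for every $\Phi \in \mathcal{T}(\mathbb{R})$. *)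

theory Defs
  imports "HOL-Analysis.Analysis" "HOL-Probability.Essential_Supremum"
begin

text \<open>
  Elements of \<open>L\<^sup>\<infinity>(\<real>)\<close> and \<open>L\<^sup>1(\<real>)\<close> are represented by Lebesgue measurable
  functions, not by classes modulo almost-everywhere equality. The library's \<^const>\<open>esssup\<close> takes
  the value \<open>\<infinity>\<close> on non-measurable functions; the norm is kept in \<^typ>\<open>ereal\<close> so that this value
  is not lost.
\<close>

definition Linf_norm :: "(real \<Rightarrow> complex) \<Rightarrow> ereal" where
  "Linf_norm \<phi> = esssup lebesgue (\<lambda>x. ereal (norm (\<phi> x)))"

definition Linf :: "(real \<Rightarrow> complex) set" where
  "Linf = {\<phi> \<in> borel_measurable lebesgue. Linf_norm \<phi> < \<infinity>}"

definition prob_densities :: "(real \<Rightarrow> real) set" where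
  "prob_densities =
     {f. integrable lebesgue f \<and> (AE x in lebesgue. f x \<ge> 0) \<and> (LINT x|lebesgue. f x) = 1}"

definition conv :: "(real \<Rightarrow> real) \<Rightarrow> (real \<Rightarrow> complex) \<Rightarrow> real \<Rightarrow> complex" where
  "conv f \<phi> x = (LINT t|lebesgue. \<phi> (x - t) * of_real (f t))"

definition dilate :: "real \<Rightarrow> (real \<Rightarrow> real) \<Rightarrow> real \<Rightarrow> real" where
  "dilate r f x = inverse r * f (x / r)"

text \<open>
  The dual space \<open>L\<^sup>\<infinity>(\<real>)\<^sup>*\<close>. Boundedness forces \<open>\<Phi> \<phi> = \<Phi> \<psi>\<close> whenever
  \<open>\<phi>, \<psi> \<in> L\<^sup>\<infinity>(\<real>)\<close> agree almost everywhere, so \<open>\<Phi>\<close> descends to a functional on classes.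
  The values of \<open>\<Phi>\<close> outside \<^const>\<open>Linf\<close> are irrelevant.
\<close>

definition Linf_dual :: "((real \<Rightarrow> complex) \<Rightarrow> complex) set" where
  "Linf_dual = {\<Phi>.
     (\<forall>\<phi>\<in>Linf. \<forall>\<psi>\<in>Linf. \<Phi> (\<lambda>x. \<phi> x + \<psi> x) = \<Phi> \<phi> + \<Phi> \<psi>) \<and>
     (\<forall>c. \<forall>\<phi>\<in>Linf. \<Phi> (\<lambda>x. c * \<phi> x) = c * \<Phi> \<phi>) \<and>
     (\<exists>C::real. \<forall>\<phi>\<in>Linf. ereal (norm (\<Phi> \<phi>)) \<le> ereal C * Linf_norm \<phi>)}"

definition is_mean :: "((real \<Rightarrow> complex) \<Rightarrow> complex) \<Rightarrow> bool" where
  "is_mean \<Phi> \<longleftrightarrow> \<Phi> \<in> Linf_dual \<and>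
     (\<forall>\<phi>\<in>Linf. (AE x in lebesgue. \<phi> x \<in> \<real>\<^sub>\<ge>\<^sub>0) \<longrightarrow> \<Phi> \<phi> \<in> \<real>\<^sub>\<ge>\<^sub>0) \<and>
     \<Phi> (\<lambda>x. 1) = 1"

definition topologically_invariant_means :: "((real \<Rightarrow> complex) \<Rightarrow> complex) set" where
  "topologically_invariant_means =
     {\<Phi>. is_mean \<Phi> \<and> (\<forall>g\<in>prob_densities. \<forall>\<phi>\<in>Linf. \<Phi> (conv g \<phi>) = \<Phi> \<phi>)}"

definition almost_convergent :: "(real \<Rightarrow> complex) \<Rightarrow> complex \<Rightarrow> bool" where
  "almost_convergent \<phi> \<alpha> \<longleftrightarrow> (\<forall>\<Phi>\<in>topologically_invariant_means. \<Phi> \<phi> = \<alpha>)"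

end

theory Submission
  imports Defs
begin

text \<open>
  If \<open>f\<^sub>r * \<phi>\<close> tends to \<open>\<alpha>\<close> in norm, then every topologically invariant mean \<open>\<Phi>\<close> satisfies
  \<open>\<Phi> \<phi> = \<Phi> (f\<^sub>r * \<phi>)\<close>, which tends to \<open>\<alpha>\<close> by boundedness. Conversely, if uniform convergence
  fails, there are \<open>e > 0\<close>, arbitrarily large \<open>r\<close> and points \<open>y r\<close> with
  \<open>\<bar>(f\<^sub>r * \<phi>) (y r) - \<alpha>\<bar> \<ge> e\<close>. The functionals \<open>\<psi> \<mapsto> (f\<^sub>r * \<psi>) (y r)\<close> are means, and by Tychonoff's
  theorem they have a pointwise cluster point \<open>\<Phi>\<close>, which is a mean with \<open>\<Phi> \<phi> \<noteq> \<alpha>\<close>. It is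
  topologically invariant because \<open>f\<^sub>r * (g * \<psi>) - f\<^sub>r * \<psi>\<close> tends uniformly to \<open>0\<close>, being bounded by
  \<open>\<parallel>\<psi>\<parallel>\<^sub>\<infinity> \<integral> g(s) \<parallel>f(\<cdot> - s/r) - f\<parallel>\<^sub>1 ds\<close>; here continuity of translation in \<open>L\<^sup>1\<close> enters.
\<close>

section \<open>Continuity of translation in \<open>L\<^sup>1\<close>\<close>

lemma lborel_integral_translate:
  fixes f :: "real \<Rightarrow> 'a :: {banach, second_countable_topology}"
  shows "(LINT x|lborel. f (x + h)) = (LINT x|lborel. f x)"
  using lborel_integral_real_affine[of 1 f h] by (simp add: add.commute)

lemma lborel_integrable_translate:
  fixes f :: "real \<Rightarrow> 'a :: {banach, second_countable_topology}"
  assumes "integrable lborel f"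
  shows "integrable lborel (\<lambda>x. f (x + h))"
  using lborel_integrable_real_affine[OF assms, of 1 h] by (simp add: add.commute)

text \<open>An epsilon/3 argument: Lebesgue measure is translation invariant, so passing from
  \<open>f\<close> to \<open>g\<close> costs at most twice their L^1 distance, for every shift at
  once. It serves both the indicator case and the limit case of the induction below.\<close>

lemma L1_translation_approx:
  fixes f :: "real \<Rightarrow> 'a :: {banach, second_countable_topology}"
  assumes f: "integrable lborel f"
    and approx: "\<And>e. e > 0 \<Longrightarrow> \<exists>g. integrable lborel g \<and> (LINT x|lborel. norm (f x - g x)) < e \<and>
      (\<lambda>n. LINT x|lborel. norm (g (x + X n) - g x)) \<longlonglongrightarrow> 0"
  shows "(\<lambda>n. LINT x|lborel. norm (f (x + X n) - f x)) \<longlonglongrightarrow> 0"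
proof (rule LIMSEQ_I)
  fix e :: real assume "e > 0"
  then obtain g where g: "integrable lborel g" and fg: "(LINT x|lborel. norm (f x - g x)) < e / 3"
    and lim: "(\<lambda>n. LINT x|lborel. norm (g (x + X n) - g x)) \<longlonglongrightarrow> 0"
    using approx[of "e / 3"] by auto
  note [simp] = f g lborel_integrable_translate[OF f] lborel_integrable_translate[OF g]
  have *: "(LINT x|lborel. norm (f (x + h) - f x)) \<le>
      (LINT x|lborel. norm (g (x + h) - g x)) + 2 * (LINT x|lborel. norm (f x - g x))" for h
  proof -
    have "(LINT x|lborel. norm (f (x + h) - f x)) \<le>
        (LINT x|lborel. norm (g (x + h) - g x) + norm (f (x + h) - g (x + h)) + norm (f x - g x))"
    proof (rule integral_mono)
      show "norm (f (x + h) - f x) \<le>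
          norm (g (x + h) - g x) + norm (f (x + h) - g (x + h)) + norm (f x - g x)" for x
        using norm_triangle_ineq4[of "f (x+h) - g (x+h) + (g (x+h) - g x)" "f x - g x"]
          norm_triangle_ineq[of "f (x+h) - g (x+h)" "g (x+h) - g x"]
        by (simp add: algebra_simps)
    qed auto
    also have "\<dots> = (LINT x|lborel. norm (g (x + h) - g x)) +
        (LINT x|lborel. norm (f (x + h) - g (x + h))) + (LINT x|lborel. norm (f x - g x))"
      by (subst Bochner_Integration.integral_add; simp)+
    also have "(LINT x|lborel. norm (f (x + h) - g (x + h))) = (LINT x|lborel. norm (f x - g x))"
      by (rule lborel_integral_translate)
    finally show ?thesis by simp
  qed
  obtain N where N: "\<And>n. n \<ge> N \<Longrightarrow> norm ((LINT x|lborel. norm (g (x + X n) - g x)) - 0) < e / 3"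
    using LIMSEQ_D[OF lim, of "e / 3"] \<open>e > 0\<close> by auto
  show "\<exists>N. \<forall>n\<ge>N. norm ((LINT x|lborel. norm (f (x + X n) - f x)) - 0) < e"
  proof (intro exI allI impI)
    fix n assume "n \<ge> N"
    from N[OF this] *[of "X n"] fg
    show "norm ((LINT x|lborel. norm (f (x + X n) - f x)) - 0) < e"
      by (simp add: integral_nonneg_AE)
  qed
qed

text \<open>For values a, b in {0, 1} one has |a - b| = a + b - 2ab, so only the overlap of
  \<open>U\<close> with its translates matters. Openness makes its integrand converge at every
  point: if x lies in \<open>U\<close>, then so does \<open>x + X n\<close> from some n on, and off
  \<open>U\<close> the product vanishes. Dominated convergence does the rest.\<close>

lemma L1_translation_open:
  fixes c :: "'a :: {banach, second_countable_topology}"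
  assumes U: "open U" "emeasure lborel U < \<infinity>" and X: "X \<longlonglongrightarrow> (0::real)"
  shows "(\<lambda>n. LINT x|lborel. norm (indicator U (x + X n) *\<^sub>R c - indicator U x *\<^sub>R c)) \<longlonglongrightarrow> 0"
proof -
  have [measurable]: "U \<in> sets borel" using U by auto
  let ?I = "indicator U :: real \<Rightarrow> real"
  have int[simp]: "integrable lborel ?I" using U by (simp add: integrable_indicator_iff)
  note inth[simp] = lborel_integrable_translate[OF int]
  have intm[simp]: "integrable lborel (\<lambda>x. ?I x * ?I (x + h))" for h
    by (rule Bochner_Integration.integrable_bound[OF int]) (auto simp: indicator_def)
  have "(\<lambda>n. LINT x|lborel. ?I x * ?I (x + X n)) \<longlonglongrightarrow> (LINT x|lborel. ?I x)"
  proof (rule integral_dominated_convergence[where w = ?I])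
    have "(\<lambda>n. ?I x * ?I (x + X n)) \<longlonglongrightarrow> ?I x" for x
    proof (cases "x \<in> U")
      case True
      have "(\<lambda>n. x + X n) \<longlonglongrightarrow> x" using tendsto_add[OF tendsto_const X, of x] by simp
      then have "eventually (\<lambda>n. x + X n \<in> U) sequentially"
        using True U(1) topological_tendstoD by blast
      then have "eventually (\<lambda>n. ?I x * ?I (x + X n) = ?I x) sequentially"
        by eventually_elim (simp add: True)
      then show ?thesis by (rule tendsto_eventually)
    qed simp
    then show "AE x in lborel. (\<lambda>n. ?I x * ?I (x + X n)) \<longlonglongrightarrow> ?I x" by simp
  qed (auto simp: indicator_def)
  from tendsto_diff[OF tendsto_const this, of "LINT x|lborel. ?I x"]
  have "(\<lambda>n. norm c * (2 * ((LINT x|lborel. ?I x) - (LINT x|lborel. ?I x * ?I (x + X n))))) \<longlonglongrightarrow>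
      norm c * (2 * 0)"
    by (intro tendsto_mult tendsto_const) simp
  moreover have "(LINT x|lborel. norm (?I (x + h) *\<^sub>R c - ?I x *\<^sub>R c)) =
      norm c * (2 * ((LINT x|lborel. ?I x) - (LINT x|lborel. ?I x * ?I (x + h))))" for h
  proof -
    have "(LINT x|lborel. norm (?I (x + h) *\<^sub>R c - ?I x *\<^sub>R c)) =
        (LINT x|lborel. norm c * (?I (x + h) + ?I x - 2 * (?I x * ?I (x + h))))"
      by (rule Bochner_Integration.integral_cong) (auto simp: indicator_def)
    also have "\<dots> = norm c * ((LINT x|lborel. ?I (x + h)) + (LINT x|lborel. ?I x) -
        2 * (LINT x|lborel. ?I x * ?I (x + h)))"
      by simp
    finally show ?thesis by (simp only: lborel_integral_translate) simp
  qed
  ultimately show ?thesis by simp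
qed

text \<open>Induction over integrable functions: a measurable set of finite measure is approximated
  from outside by an open set, sums follow from the triangle inequality, and limits are reduced to
  one close simple function.\<close>

proposition L1_translation_continuous:
  fixes f :: "real \<Rightarrow> 'a :: {banach, second_countable_topology}"
  assumes "integrable lborel f" and X: "X \<longlonglongrightarrow> 0"
  shows "(\<lambda>n. LINT x|lborel. norm (f (x + X n) - f x)) \<longlonglongrightarrow> 0"
  using assms(1)
proof (induction f rule: integrable_induct)
  case (base A c)
  then have A[measurable]: "A \<in> sets borel" and fin: "emeasure lborel A < \<infinity>" by auto
  have intA: "integrable lborel (indicator A :: real \<Rightarrow> real)"
    using fin by (simp add: integrable_indicator_iff)
  show ?case
  proof (rule L1_translation_approx)
    show "integrable lborel (\<lambda>x. indicator A x *\<^sub>R c)" using intA by simp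
    fix e :: real assume "e > 0"
    \<comment> \<open>Adding 1 to \<open>norm c\<close> keeps the quotient meaningful for c = 0 and
      makes \<open>norm c * d < e\<close> strict.\<close>
    define d where "d = e / (norm c + 1)"
    have "d > 0" using \<open>e > 0\<close> by (simp add: d_def add_nonneg_pos)
    obtain U where U: "open U" "A \<subseteq> U" "emeasure lborel (U - A) < d"
      using outer_regular_lborel[OF A \<open>d > 0\<close>] by blast
    have [measurable]: "U \<in> sets borel" using U by auto
    have "emeasure lborel U = emeasure lborel A + emeasure lborel (U - A)"
      using U(2) by (subst plus_emeasure) (auto intro: arg_cong[where f = "emeasure lborel"])
    moreover have "emeasure lborel (U - A) < \<infinity>"
      using U(3) by (rule less_trans) simp
    ultimately have finU: "emeasure lborel U < \<infinity>" using fin by simp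
    have intU: "integrable lborel (indicator U :: real \<Rightarrow> real)"
      using finU by (simp add: integrable_indicator_iff)
    have "(LINT x|lborel. norm (indicator A x *\<^sub>R c - indicator U x *\<^sub>R c)) =
        (LINT x|lborel. norm c * indicator (U - A) x)"
      using U(2) by (intro Bochner_Integration.integral_cong) (auto simp: indicator_def)
    also have "\<dots> = norm c * measure lborel (U - A)" by simp
    also have "\<dots> \<le> norm c * d"
    proof (rule mult_left_mono)
      show "measure lborel (U - A) \<le> d"
        using U(3) \<open>d > 0\<close> by (simp add: measure_def enn2real_leI)
    qed simp
    also have "\<dots> < (norm c + 1) * d" using \<open>d > 0\<close> by (simp add: distrib_right)
    also have "\<dots> = e" using norm_ge_zero[of c] by (simp add: d_def add_nonneg_eq_0_iff)
    finally show "\<exists>g. integrable lborel g \<and> (LINT x|lborel. norm (indicator A x *\<^sub>R c - g x)) < e \<and>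
        (\<lambda>n. LINT x|lborel. norm (g (x + X n) - g x)) \<longlonglongrightarrow> 0"
      using intU L1_translation_open[OF U(1) finU X, of c]
      by (intro exI[of _ "\<lambda>x. indicator U x *\<^sub>R c"]) simp
  qed
next
  case (add f g)
  note [simp] = add.hyps lborel_integrable_translate[OF add.hyps(1)] lborel_integrable_translate[OF add.hyps(2)]
  from tendsto_add[OF add.IH]
  have lim: "(\<lambda>n. (LINT x|lborel. norm (f (x + X n) - f x)) + (LINT x|lborel. norm (g (x + X n) - g x))) \<longlonglongrightarrow> 0"
    by simp
  show ?case
  proof (rule tendsto_sandwich[OF _ _ tendsto_const lim])
    have "(LINT x|lborel. norm (f (x + h) + g (x + h) - (f x + g x))) \<le>
        (LINT x|lborel. norm (f (x + h) - f x) + norm (g (x + h) - g x))" for h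
    proof (rule integral_mono)
      show "norm (f (x + h) + g (x + h) - (f x + g x)) \<le> norm (f (x + h) - f x) + norm (g (x + h) - g x)" for x
        by (rule norm_diff_triangle_ineq)
    qed auto
    then show "eventually (\<lambda>n. (LINT x|lborel. norm (f (x + X n) + g (x + X n) - (f x + g x))) \<le>
        (LINT x|lborel. norm (f (x + X n) - f x)) + (LINT x|lborel. norm (g (x + X n) - g x))) sequentially"
      by simp
  qed (simp add: integral_nonneg_AE)
next
  case (lim f s)
  show ?case
  proof (rule L1_translation_approx)
    fix e :: real assume "e > 0"
    have [measurable]: "s i \<in> borel_measurable borel" "f \<in> borel_measurable borel" for i
      using lim.hyps(1)[of i] lim.hyps(4) by (auto dest: borel_measurable_integrable)
    \<comment> \<open>The induction rule supplies the bound
      \<open>norm (s i x) \<le> 2 * norm (f x)\<close>, hence the dominating function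
      \<open>3 * norm (f x)\<close>.\<close>
    have "(\<lambda>i. LINT x|lborel. norm (f x - s i x)) \<longlonglongrightarrow> (LINT (x::real)|lborel. (0::real))"
    proof (rule integral_dominated_convergence[where w = "\<lambda>x. 3 * norm (f x)"])
      show "AE x in lborel. (\<lambda>i. norm (f x - s i x)) \<longlonglongrightarrow> 0"
      proof (rule AE_I2)
        fix x assume "x \<in> space (lborel :: real measure)"
        from tendsto_norm[OF tendsto_diff[OF tendsto_const lim.hyps(2)[OF this], of "f x"]]
        show "(\<lambda>i. norm (f x - s i x)) \<longlonglongrightarrow> 0" by simp
      qed
      show "AE x in lborel. norm (norm (f x - s i x)) \<le> 3 * norm (f x)" for i
      proof (rule AE_I2)
        fix x assume "x \<in> space (lborel :: real measure)"
        from lim.hyps(3)[OF this, of i] norm_triangle_ineq4[of "f x" "s i x"]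
        show "norm (norm (f x - s i x)) \<le> 3 * norm (f x)" by simp
      qed
      show "integrable lborel (\<lambda>x. 3 * norm (f x))" using lim.hyps(4) by simp
    qed auto
    then have "eventually (\<lambda>i. (LINT x|lborel. norm (f x - s i x)) < e) sequentially"
      using \<open>e > 0\<close> order_tendstoD(2) by fastforce
    then obtain i where "(LINT x|lborel. norm (f x - s i x)) < e"
      by (auto simp: eventually_sequentially)
    then show "\<exists>g. integrable lborel g \<and> (LINT x|lborel. norm (f x - g x)) < e \<and>
        (\<lambda>n. LINT x|lborel. norm (g (x + X n) - g x)) \<longlonglongrightarrow> 0"
      using lim.hyps(1) lim.IH by blast
  qed (rule lim.hyps(4))
qed

section \<open>Convolution of Borel functions\<close>

lemma borel_measurable_integrable_lborel: "integrable lborel f \<Longrightarrow> f \<in> borel_measurable borel"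
  using borel_measurable_integrable[of lborel f] by simp

text \<open>For Borel functions the integral over the completed measure may be taken over
  \<open>lborel\<close>, where joint measurability and Fubini's theorem are at hand.\<close>

lemma conv_eq_lborel:
  assumes [measurable]: "f \<in> borel_measurable borel" "\<psi> \<in> borel_measurable borel"
  shows "conv f \<psi> x = (LINT t|lborel. \<psi> (x - t) * of_real (f t))"
  unfolding conv_def by (rule integral_completion) measurable

lemma conv_measurable:
  assumes [measurable]: "f \<in> borel_measurable borel" "\<psi> \<in> borel_measurable borel"
  shows "conv f \<psi> \<in> borel_measurable borel"
proof -
  have "conv f \<psi> = (\<lambda>x. LINT t|lborel. \<psi> (x - t) * of_real (f t))"
    by (rule ext) (rule conv_eq_lborel[OF assms])
  then show ?thesis by simp
qed

context
  fixes f :: "real \<Rightarrow> real" and \<psi> :: "real \<Rightarrow> complex" and M :: real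
  assumes f: "integrable lborel f"
    and \<psi>[measurable]: "\<psi> \<in> borel_measurable borel"
    and M: "\<And>x. norm (\<psi> x) \<le> M"
begin

lemma integrable_conv: "integrable lborel (\<lambda>t. \<psi> (x - t) * of_real (f t))"
proof -
  note borel_measurable_integrable_lborel[OF f, measurable]
  show ?thesis
  proof (rule Bochner_Integration.integrable_bound)
    show "integrable lborel (\<lambda>t. M * norm (f t))" using f by simp
    show "AE t in lborel. norm (\<psi> (x - t) * of_real (f t)) \<le> norm (M * norm (f t))"
      by (auto simp: norm_mult abs_mult intro!: AE_I2 mult_right_mono order_trans[OF M abs_ge_self])
  qed measurable
qed

text \<open>Nothing but boundedness is known of \<psi>, so the shift is moved onto \<open>f\<close>
  by substitution. What remains is an integral of \<psi> against the difference of \<open>f\<close>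
  and its translate.\<close>

lemma norm_conv_diff_le:
  "norm (conv f \<psi> (x - s) - conv f \<psi> x) \<le> M * (LINT t|lborel. norm (f (t + - s) - f t))"
proof -
  note borel_measurable_integrable_lborel[OF f, measurable]
  note [simp] = f lborel_integrable_translate[OF f, of "- s", simplified]
  have "conv f \<psi> (x - s) = (LINT t|lborel. \<psi> (x - (t + s)) * of_real (f t))"
    by (simp add: conv_eq_lborel algebra_simps)
  also have "\<dots> = (LINT t|lborel. \<psi> (x - t) * of_real (f (t + - s)))"
    using lborel_integral_translate[of "\<lambda>t. \<psi> (x - t) * of_real (f (t + - s))" s] by simp
  finally have shift: "conv f \<psi> (x - s) = \<dots>" .
  have "integrable lborel (\<lambda>t. \<psi> (x - s - t) * of_real (f t))" by (rule integrable_conv)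
  from lborel_integrable_translate[OF this, of "- s"]
  have i: "integrable lborel (\<lambda>t. \<psi> (x - t) * of_real (f (t + - s)))" by (simp add: algebra_simps)
  have "conv f \<psi> (x - s) - conv f \<psi> x =
      (LINT t|lborel. \<psi> (x - t) * of_real (f (t + - s) - f t))"
    unfolding shift conv_eq_lborel[OF borel_measurable_integrable_lborel[OF f] \<psi>, of x]
    by (subst Bochner_Integration.integral_diff[symmetric, OF i integrable_conv]) (simp add: algebra_simps)
  also have "norm \<dots> \<le> (LINT t|lborel. M * norm (f (t + - s) - f t))"
  proof (rule Bochner_Integration.integral_norm_bound_integral)
    show "norm (\<psi> (x - t) * of_real (f (t + - s) - f t)) \<le> M * norm (f (t + - s) - f t)" for t
      unfolding norm_mult norm_of_real real_norm_def by (intro mult_right_mono M) simp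
    show "integrable lborel (\<lambda>t. \<psi> (x - t) * of_real (f (t + - s) - f t))"
      using Bochner_Integration.integrable_diff[OF i integrable_conv[of x]]
      by (simp add: algebra_simps)
  qed simp
  finally show ?thesis by simp
qed

lemma norm_conv_le: "norm (conv f \<psi> x) \<le> M * (LINT t|lborel. norm (f t))"
proof -
  have "norm (conv f \<psi> x) \<le> (LINT t|lborel. M * norm (f t))"
    unfolding conv_eq_lborel[OF borel_measurable_integrable_lborel[OF f] \<psi>]
    by (intro Bochner_Integration.integral_norm_bound_integral integrable_conv) (auto simp: f M norm_mult mult_right_mono)
  then show ?thesis by simp
qed

text \<open>Both sides unfold to the same double integral, with \<psi> evaluated at x - s - t, in
  opposite orders. Fubini applies because the integrand is dominated by M |g(s)| |f(t)|.\<close>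

lemma conv_commute:
  assumes g: "integrable lborel g"
  shows "conv f (conv g \<psi>) x = conv g (conv f \<psi>) x"
proof -
  note g_borel[measurable] = borel_measurable_integrable_lborel[OF g]
  note borel_measurable_integrable_lborel[OF f, measurable]
  let ?F = "\<lambda>s t. \<psi> (x - s - t) * of_real (f t) * of_real (g s)"
  have "integrable (lborel \<Otimes>\<^sub>M lborel) (\<lambda>(s, t). ?F s t)"
  proof (rule Bochner_Integration.integrable_bound)
    show "integrable (lborel \<Otimes>\<^sub>M lborel) (\<lambda>(s, t). M * (norm (g s) * norm (f t)))"
    proof (rule lborel_pair.Fubini_integrable)
      show "integrable lborel (\<lambda>s. LINT t|lborel. norm (case (s, t) of (s, t) \<Rightarrow> M * (norm (g s) * norm (f t))))"
        using f g by (simp add: abs_mult)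
    qed (use f in auto)
    show "AE p in lborel \<Otimes>\<^sub>M lborel. norm (case p of (s, t) \<Rightarrow> ?F s t)
        \<le> norm (case p of (s, t) \<Rightarrow> M * (norm (g s) * norm (f t)))"
      using mult_right_mono[OF order_trans[OF M abs_ge_self], of "\<bar>f b\<bar> * \<bar>g a\<bar>" for a b]
      by (auto simp: norm_mult abs_mult mult_ac intro!: AE_I2)
  qed measurable
  from lborel_pair.Fubini_integral[OF this]
  have "(LINT t|lborel. LINT s|lborel. ?F s t) = (LINT s|lborel. LINT t|lborel. ?F s t)" .
  moreover have "conv f (conv g \<psi>) x = (LINT t|lborel. LINT s|lborel. ?F s t)"
  proof -
    note [measurable] = conv_measurable[OF g_borel \<psi>]
    have "conv f (conv g \<psi>) x = (LINT t|lborel. (LINT s|lborel. \<psi> (x - t - s) * of_real (g s)) * of_real (f t))"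
      by (simp add: conv_eq_lborel)
    also have "\<dots> = (LINT t|lborel. LINT s|lborel. ?F s t)"
      by (simp add: algebra_simps flip: integral_mult_left_zero)
    finally show ?thesis .
  qed
  moreover have "conv g (conv f \<psi>) x = (LINT s|lborel. LINT t|lborel. ?F s t)"
    by (simp add: conv_eq_lborel conv_measurable)
  ultimately show ?thesis by simp
qed

end

section \<open>Dilations and asymptotic invariance\<close>

lemma integral_abs_dilate_translate:
  assumes "r > 0"
  shows "(LINT t|lborel. norm (dilate r f (t + - s) - dilate r f t)) =
    (LINT t|lborel. norm (f (t + - s / r) - f t))"
proof -
  \<comment> \<open>Substituting r t for t cancels the factor 1/r of the dilation and shrinks the
    shift from s to s/r: this is why large r makes the dilated density almost translation
    invariant.\<close>
  have "(LINT t|lborel. norm (dilate r f (t + - s) - dilate r f t)) =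
    \<bar>r\<bar> *\<^sub>R (LINT t|lborel. norm (dilate r f ((0 + r * t) + - s) - dilate r f (0 + r * t)))"
    using assms by (intro lborel_integral_real_affine) simp
  also have "(\<lambda>t. norm (dilate r f ((0 + r * t) + - s) - dilate r f (0 + r * t))) =
      (\<lambda>t. inverse r * norm (f (t + - s / r) - f t))"
    using assms by (auto simp: dilate_def diff_divide_distrib abs_mult simp flip: right_diff_distrib)
  finally show ?thesis using assms by simp
qed

lemma integrable_dilate:
  assumes "integrable lborel f" "r > 0"
  shows "integrable lborel (dilate r f)"
  using lborel_integrable_real_affine[OF assms(1), of "1 / r" 0] assms(2)
  by (simp add: dilate_def[abs_def])

text \<open>After commuting the convolutions, the difference is an average with weight
  \<open>g\<close> of increments of \<open>conv (dilate r f) \<psi>\<close> over shifts s, each at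
  most M times the L^1 modulus of continuity \<omega> of \<open>f\<close> at s/r. This modulus tends
  to 0 for fixed s and never exceeds twice the L^1 norm of \<open>f\<close>, so dominated
  convergence applies. The bound \<delta> does not depend on the point x.\<close>

proposition conv_dilate_asymptotically_invariant:
  fixes f g :: "real \<Rightarrow> real" and \<psi> :: "real \<Rightarrow> complex"
  assumes f: "integrable lborel f" and g: "integrable lborel g" "\<And>x. g x \<ge> 0" "(LINT x|lborel. g x) = 1"
    and \<psi>[measurable]: "\<psi> \<in> borel_measurable borel" and M: "\<And>x. norm (\<psi> x) \<le> M"
  obtains \<delta> where "(\<delta> \<longlongrightarrow> 0) at_top"
    and "\<And>r x. r > 0 \<Longrightarrow> norm (conv (dilate r f) (conv g \<psi>) x - conv (dilate r f) \<psi> x) \<le> \<delta> r"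
proof -
  define \<omega> where "\<omega> s = (LINT t|lborel. norm (f (t + - s) - f t))" for s
  define \<delta> where "\<delta> r = (LINT s|lborel. M * (\<omega> (s / r) * g s))" for r
  note [measurable] = borel_measurable_integrable_lborel[OF g(1)] borel_measurable_integrable_lborel[OF f]
  have \<omega>_meas[measurable]: "\<omega> \<in> borel_measurable borel" unfolding \<omega>_def[abs_def] by measurable
  have "M \<ge> 0" using M[of 0] norm_ge_zero order_trans by blast
  have \<omega>_nonneg: "\<omega> s \<ge> 0" for s by (simp add: \<omega>_def integral_nonneg_AE)
  have \<omega>_le: "\<omega> s \<le> 2 * (LINT t|lborel. norm (f t))" for s
  proof -
    note [simp] = f lborel_integrable_translate[OF f, of "- s", simplified]
    have "\<omega> s \<le> (LINT t|lborel. norm (f (t + - s)) + norm (f t))"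
      unfolding \<omega>_def by (rule integral_mono) (auto intro: norm_triangle_ineq4)
    also have "\<dots> = (LINT t|lborel. norm (f (t + - s))) + (LINT t|lborel. norm (f t))"
      by (rule Bochner_Integration.integral_add) simp_all
    also have "(LINT t|lborel. norm (f (t + - s))) = (LINT t|lborel. norm (f t))"
      by (rule lborel_integral_translate)
    finally show ?thesis by simp
  qed
  have bound: "norm (M * (\<omega> s * g t)) \<le> M * (2 * (LINT t|lborel. norm (f t)) * g t)" for s t
    using \<omega>_nonneg[of s] \<omega>_le[of s] g(2)[of t] \<open>M \<ge> 0\<close>
    by (simp add: abs_mult mult_left_mono mult_right_mono)
  have intw: "integrable lborel (\<lambda>t. M * (2 * (LINT t|lborel. norm (f t)) * g t))" using g(1) by simp
  have intd: "integrable lborel (\<lambda>s. M * (\<omega> (s / r) * g s))" for r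
  proof (rule Bochner_Integration.integrable_bound[OF intw])
    show "AE s in lborel. norm (M * (\<omega> (s / r) * g s)) \<le> norm (M * (2 * (LINT t|lborel. norm (f t)) * g s))"
      by (intro AE_I2 order_trans[OF bound]) simp
  qed measurable
  have "(\<delta> \<longlongrightarrow> (LINT (s::real)|lborel. (0::real))) at_top"
    unfolding \<delta>_def[abs_def]
  proof (rule Bochner_Integration.integral_dominated_convergence_at_top)
    show "\<forall>\<^sub>F r in at_top. AE s in lborel. norm (M * (\<omega> (s / r) * g s)) \<le> M * (2 * (LINT t|lborel. norm (f t)) * g s)"
      using bound by simp
    \<comment> \<open>Continuity of translation was proved for sequences of shifts, so the limit at
      infinity is tested along sequences \<open>X\<close>.\<close>
    have "((\<lambda>r. \<omega> (s / r)) \<longlongrightarrow> 0) at_top" for s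
    proof (rule tendsto_at_topI_sequentially)
      fix X :: "nat \<Rightarrow> real" assume X: "filterlim X at_top sequentially"
      have "(\<lambda>n. - (s / X n)) \<longlonglongrightarrow> - 0"
        by (intro tendsto_minus tendsto_divide_0[OF tendsto_const] filterlim_at_top_imp_at_infinity X)
      then have "(\<lambda>n. LINT t|lborel. norm (f (t + - (s / X n)) - f t)) \<longlonglongrightarrow> 0"
        by (intro L1_translation_continuous f) simp
      then show "(\<lambda>n. \<omega> (s / X n)) \<longlonglongrightarrow> 0" by (simp add: \<omega>_def)
    qed
    then have "((\<lambda>r. M * (\<omega> (s / r) * g s)) \<longlongrightarrow> M * (0 * g s)) at_top" for s
      by (intro tendsto_mult tendsto_const)
    then show "AE s in lborel. ((\<lambda>r. M * (\<omega> (s / r) * g s)) \<longlongrightarrow> 0) at_top" by simp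
  qed (use intw in auto)
  moreover have "norm (conv (dilate r f) (conv g \<psi>) x - conv (dilate r f) \<psi> x) \<le> \<delta> r" if "r > 0" for r x
  proof -
    let ?f = "dilate r f"
    note intf = integrable_dilate[OF f that]
    note [measurable] = conv_measurable[OF borel_measurable_integrable_lborel[OF intf] \<psi>]
    have i: "integrable lborel (\<lambda>s. conv ?f \<psi> (x - s) * of_real (g s))"
      by (rule integrable_conv[OF g(1) _ norm_conv_le[OF intf \<psi> M]]) measurable
    \<comment> \<open>The total mass 1 of \<open>g\<close> is inserted as a factor, so that the
      subtracted value becomes an integral against \<open>g\<close> too and both terms merge under
      one integral.\<close>
    have "conv ?f (conv g \<psi>) x - conv ?f \<psi> x = conv g (conv ?f \<psi>) x - conv ?f \<psi> x * of_real (LINT s|lborel. g s)"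
      using g(3) by (simp add: conv_commute[OF intf \<psi> M g(1)])
    also have "\<dots> = (LINT s|lborel. (conv ?f \<psi> (x - s) - conv ?f \<psi> x) * of_real (g s))"
      using i g(1) by (simp add: conv_eq_lborel left_diff_distrib)
    also have "norm \<dots> \<le> \<delta> r"
      unfolding \<delta>_def
    proof (rule Bochner_Integration.integral_norm_bound_integral)
      show "integrable lborel (\<lambda>s. (conv ?f \<psi> (x - s) - conv ?f \<psi> x) * of_real (g s))"
        using i g(1) by (simp add: left_diff_distrib)
      show "norm ((conv ?f \<psi> (x - s) - conv ?f \<psi> x) * of_real (g s)) \<le> M * (\<omega> (s / r) * g s)" for s
        using norm_conv_diff_le[OF intf \<psi> M, of x s] g(2)[of s]
        unfolding integral_abs_dilate_translate[OF that] \<omega>_def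
        by (simp add: norm_mult mult_right_mono flip: mult.assoc)
    qed (rule intd)
    finally show ?thesis .
  qed
  ultimately show thesis by (intro that[of \<delta>]) simp_all
qed

section \<open>Convolution on \<open>L\<^sup>\<infinity>\<close>\<close>

text \<open>Lebesgue measurability can be lost under composition with a Borel map; a nonconstant
  affine map is harmless because it pulls null sets back to null sets.\<close>

lemma lebesgue_measurable_affine:
  fixes c :: real
  assumes "f \<in> borel_measurable lebesgue" "c \<noteq> 0"
  shows "(\<lambda>x. f (t + c * x)) \<in> borel_measurable lebesgue"
proof -
  have "(\<lambda>x. t + c * x) \<in> lebesgue \<rightarrow>\<^sub>M lebesgue"
    using lebesgue_affine_measurable[where c = "\<lambda>x::real. c"] assms(2) by simp
  from measurable_compose[OF this assms(1)] show ?thesis .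
qed

lemma AE_lebesgue_affine:
  fixes c :: real
  assumes P: "AE x in lebesgue. P x" and c: "c \<noteq> 0"
  shows "AE x in lebesgue. P (t + c * x)"
proof -
  obtain N where N: "N \<in> null_sets lborel" "\<And>x. x \<in> space lborel - N \<Longrightarrow> P x"
    using AE_E3[OF P[unfolded AE_completion_iff]] by metis
  then have [measurable]: "N \<in> sets borel" by (simp add: null_sets_def)
  have "AE x in lborel. t + c * x \<notin> N"
    using N(1) by (intro AE_borel_affine[OF c] AE_not_in) (auto)
  then show ?thesis
    unfolding AE_completion_iff using N(2) by (auto elim!: eventually_mono)
qed

lemma lebesgue_measurable_reflect:
  assumes "f \<in> borel_measurable lebesgue"
  shows "(\<lambda>t. f (x - t :: real)) \<in> borel_measurable lebesgue"
  using lebesgue_measurable_affine[OF assms, of "- 1" x] by simp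

lemma AE_lebesgue_reflect:
  assumes "AE t in lebesgue. P t"
  shows "AE t in lebesgue. P (x - t :: real)"
  using AE_lebesgue_affine[OF assms, of "- 1" x] by simp

text \<open>The equality holds at every point, not just almost everywhere: for each fixed x the
  reflected exceptional set is again null. Representatives can thus be exchanged without affecting
  point evaluations of convolutions.\<close>

lemma conv_cong_AE:
  assumes "f \<in> borel_measurable lebesgue" "g \<in> borel_measurable lebesgue"
    "\<phi> \<in> borel_measurable lebesgue" "\<psi> \<in> borel_measurable lebesgue"
    and "AE t in lebesgue. f t = g t" and \<phi>\<psi>: "AE t in lebesgue. \<phi> t = \<psi> t"
  shows "conv f \<phi> = conv g \<psi>"
proof
  fix x
  note [measurable] = assms(1-4)[THEN lebesgue_measurable_reflect] assms(1-4)
  show "conv f \<phi> x = conv g \<psi> x" unfolding conv_def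
  proof (rule integral_cong_AE)
    show "AE t in lebesgue. \<phi> (x - t) * of_real (f t) = \<psi> (x - t) * of_real (g t)"
      using assms(5) AE_lebesgue_reflect[OF \<phi>\<psi>, of x] by eventually_elim simp
  qed measurable
qed

lemma completion_ex_borel_measurable_complex:
  fixes g :: "'a \<Rightarrow> complex"
  assumes [measurable]: "g \<in> borel_measurable (completion M)"
  shows "\<exists>g'\<in>borel_measurable M. (AE x in M. g x = g' x)"
proof -
  have "(\<lambda>x. Re (g x)) \<in> borel_measurable (completion M)" "(\<lambda>x. Im (g x)) \<in> borel_measurable (completion M)"
    by measurable
  then obtain u v where [measurable]: "u \<in> borel_measurable M" "v \<in> borel_measurable M"
    and ae: "AE x in M. Re (g x) = u x" "AE x in M. Im (g x) = v x"
    by (metis completion_ex_borel_measurable_real)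
  show ?thesis
  proof (rule bexI[of _ "\<lambda>x. of_real (u x) + \<i> * of_real (v x)"])
    show "AE x in M. g x = of_real (u x) + \<i> * of_real (v x)"
      using ae by eventually_elim (simp add: complex_eq_iff)
  qed measurable
qed

section \<open>The essential supremum norm and Borel representatives\<close>

lemma Linf_norm_nonneg: "0 \<le> Linf_norm \<phi>"
proof (rule ccontr)
  assume "\<not> 0 \<le> Linf_norm \<phi>"
  moreover have "AE x in lebesgue. ereal (norm (\<phi> x)) \<le> Linf_norm \<phi>"
    unfolding Linf_norm_def by (rule esssup_AE)
  \<comment> \<open>A negative essential supremum would force a negative norm almost everywhere,
    which is impossible since the whole line is not a null set.\<close>
  ultimately have "AE x in (lebesgue :: real measure). False"
    by (elim eventually_mono) (metis ereal_less_eq(5) norm_ge_zero order_trans)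
  then show False by (simp add: AE_iff_null null_sets_def)
qed

lemma Linf_norm_le:
  assumes "\<phi> \<in> borel_measurable lebesgue" "AE x in lebesgue. norm (\<phi> x) \<le> M"
  shows "Linf_norm \<phi> \<le> ereal M"
  unfolding Linf_norm_def using assms by (intro esssup_I) auto

lemma LinfI:
  assumes "\<phi> \<in> borel_measurable lebesgue" "AE x in lebesgue. norm (\<phi> x) \<le> M"
  shows "\<phi> \<in> Linf"
  using Linf_norm_le[OF assms] assms(1) by (auto simp: Linf_def)

text \<open>Setting the Borel version to 0 wherever it exceeds \<open>M\<close> turns the
  almost-everywhere bound into one valid at every point, as the Borel convolution lemmas demand,
  with \<open>M\<close> still equal to the norm.\<close>

lemma Linf_borel_representative:
  assumes "\<phi> \<in> Linf"
  obtains \<psi> M where "\<psi> \<in> borel_measurable borel" "Linf_norm \<phi> = ereal M" "\<And>x. norm (\<psi> x) \<le> M"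
    "AE x in lebesgue. \<phi> x = \<psi> x"
proof -
  have "\<phi> \<in> borel_measurable lebesgue" "Linf_norm \<phi> < \<infinity>" using assms by (auto simp: Linf_def)
  then obtain M where M: "Linf_norm \<phi> = ereal M" using Linf_norm_nonneg[of \<phi>]
    by (cases "Linf_norm \<phi>") auto
  have "M \<ge> 0" using M Linf_norm_nonneg[of \<phi>] by simp
  obtain h where h[measurable]: "h \<in> borel_measurable borel" and ae: "AE x in lborel. \<phi> x = h x"
    using completion_ex_borel_measurable_complex[OF \<open>\<phi> \<in> borel_measurable lebesgue\<close>] by auto
  show thesis
  proof (rule that[of "\<lambda>x. if norm (h x) \<le> M then h x else 0" M])
    have "AE x in lebesgue. norm (\<phi> x) \<le> M"
      using esssup_AE[of "\<lambda>x. ereal (norm (\<phi> x))" lebesgue] M by (simp add: Linf_norm_def)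
    moreover have "AE x in lebesgue. \<phi> x = h x" using ae by (simp add: AE_completion_iff)
    ultimately show "AE x in lebesgue. \<phi> x = (if norm (h x) \<le> M then h x else 0)"
      by eventually_elim auto
  qed (use M \<open>M \<ge> 0\<close> in auto)
qed

text \<open>A Borel version cut off below at 0 is nonnegative everywhere; the cut changes it only on
  a null set, so the mass stays 1.\<close>

lemma prob_densities_borel_representative:
  assumes "f \<in> prob_densities"
  obtains g where "g \<in> borel_measurable borel" "integrable lborel g" "\<And>x. g x \<ge> 0" "(LINT x|lborel. g x) = 1"
    "AE x in lebesgue. f x = g x"
proof -
  have f[measurable]: "integrable lebesgue f" "f \<in> borel_measurable lebesgue" and pos: "AE x in lebesgue. f x \<ge> 0"
    and one: "(LINT x|lebesgue. f x) = 1"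
    using assms by (auto simp: prob_densities_def)
  obtain h where h[measurable]: "h \<in> borel_measurable borel" and ae: "AE x in lborel. f x = h x"
    using completion_ex_borel_measurable_real[OF f(2)] by auto
  let ?g = "\<lambda>x. max 0 (h x)"
  have ae': "AE x in lebesgue. f x = ?g x"
    using pos ae[folded AE_completion_iff[of _ lborel]] by eventually_elim auto
  have g[measurable]: "?g \<in> borel_measurable lebesgue" by (rule measurable_completion) simp
  have "integrable lebesgue ?g" using integrable_cong_AE[OF f(2) g ae'] f(1) by simp
  then have "integrable lborel ?g" by (subst (asm) integrable_completion) auto
  moreover have "(LINT x|lebesgue. ?g x) = 1" using integral_cong_AE[OF f(2) g ae'] one by simp
  then have "(LINT x|lborel. ?g x) = 1" by (subst (asm) integral_completion) auto
  ultimately show thesis using ae' by (intro that[of ?g]) auto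
qed

lemma conv_representatives:
  assumes "f \<in> prob_densities" "\<phi> \<in> Linf"
    and "g \<in> borel_measurable borel" "AE x in lebesgue. f x = g x"
    and "\<psi> \<in> borel_measurable borel" "AE x in lebesgue. \<phi> x = \<psi> x"
  shows "conv f \<phi> = conv g \<psi>"
proof (rule conv_cong_AE)
  show "f \<in> borel_measurable lebesgue" using assms(1) by (auto simp: prob_densities_def)
  show "\<phi> \<in> borel_measurable lebesgue" using assms(2) by (simp add: Linf_def)
  show "g \<in> borel_measurable lebesgue" "\<psi> \<in> borel_measurable lebesgue"
    using assms(3,5) by (auto intro: measurable_completion)
qed (use assms in auto)

lemma integrable_conv_Linf:
  assumes f: "f \<in> prob_densities" and \<phi>: "\<phi> \<in> Linf"
  shows "integrable lebesgue (\<lambda>t. \<phi> (x - t) * of_real (f t))"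
proof -
  obtain g where g: "g \<in> borel_measurable borel" "integrable lborel g" "AE x in lebesgue. f x = g x"
    using prob_densities_borel_representative[OF f] by metis
  obtain \<psi> M where \<psi>: "\<psi> \<in> borel_measurable borel" "\<And>x. norm (\<psi> x) \<le> M" "AE x in lebesgue. \<phi> x = \<psi> x"
    using Linf_borel_representative[OF \<phi>] by metis
  have "\<phi> \<in> borel_measurable lebesgue" using \<phi> by (simp add: Linf_def)
  note [measurable] = lebesgue_measurable_reflect[OF this] g(1) \<psi>(1)
  have [measurable]: "f \<in> borel_measurable lebesgue" using f by (auto simp: prob_densities_def)
  have m: "(\<lambda>t. \<psi> (x - t) * of_real (g t)) \<in> borel_measurable lborel" by measurable
  have "integrable lebesgue (\<lambda>t. \<psi> (x - t) * of_real (g t))"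
    unfolding integrable_completion[OF m] by (rule integrable_conv[OF g(2) \<psi>(1,2)])
  moreover have "AE t in lebesgue. \<phi> (x - t) * of_real (f t) = \<psi> (x - t) * of_real (g t)"
    using g(3) AE_lebesgue_reflect[OF \<psi>(3), of x] by eventually_elim simp
  moreover have "(\<lambda>t. \<phi> (x - t) * of_real (f t)) \<in> borel_measurable lebesgue" by measurable
  ultimately show ?thesis
    using integrable_cong_AE[OF _ measurable_completion[OF m]] by blast
qed

lemma
  assumes f: "f \<in> prob_densities" and \<phi>: "\<phi> \<in> Linf"
  shows norm_conv_le_Linf_norm: "ereal (norm (conv f \<phi> x)) \<le> Linf_norm \<phi>"
    and conv_Linf: "conv f \<phi> \<in> Linf"
proof -
  obtain g where g: "g \<in> borel_measurable borel" "integrable lborel g" "\<And>x. g x \<ge> 0"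
      "(LINT x|lborel. g x) = 1" "AE x in lebesgue. f x = g x"
    using prob_densities_borel_representative[OF f] by metis
  obtain \<psi> M where \<psi>: "\<psi> \<in> borel_measurable borel" "Linf_norm \<phi> = ereal M"
      "\<And>x. norm (\<psi> x) \<le> M" "AE x in lebesgue. \<phi> x = \<psi> x"
    using Linf_borel_representative[OF \<phi>] by metis
  have eq: "conv f \<phi> = conv g \<psi>"
    by (rule conv_representatives[OF f \<phi> g(1,5) \<psi>(1,4)])
  have bound: "norm (conv f \<phi> x) \<le> M" for x
    using norm_conv_le[OF g(2) \<psi>(1,3), of x] g(3,4) by (simp add: eq)
  then show "ereal (norm (conv f \<phi> x)) \<le> Linf_norm \<phi>" by (simp add: \<psi>(2))
  show "conv f \<phi> \<in> Linf"
    using bound conv_measurable[OF g(1) \<psi>(1)]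
    by (intro LinfI[of _ M]) (auto simp: eq intro!: measurable_completion)
qed

lemma dilate_prob_densities:
  assumes f: "f \<in> prob_densities" and "r > 0"
  shows "dilate r f \<in> prob_densities"
proof -
  have 1: "integrable lebesgue (\<lambda>x. f (x / r))"
    using f lebesgue_integrable_real_affine[of f "1 / r" 0] \<open>r > 0\<close> by (simp add: prob_densities_def)
  have "(LINT x|lebesgue. f x) = \<bar>1 / r\<bar> *\<^sub>R (LINT x|lebesgue. f (0 + 1 / r * x))"
    using \<open>r > 0\<close> by (intro lebesgue_integral_real_affine) simp
  then have "(LINT x|lebesgue. dilate r f x) = 1"
    using f \<open>r > 0\<close> by (simp add: prob_densities_def dilate_def field_simps)
  moreover have "AE x in lebesgue. f x \<ge> 0" using f by (simp add: prob_densities_def)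
  from AE_lebesgue_affine[OF this, of "1 / r" 0] have "AE x in lebesgue. dilate r f x \<ge> 0"
    using \<open>r > 0\<close> by (auto simp: dilate_def)
  ultimately show ?thesis using 1 by (simp add: prob_densities_def dilate_def[abs_def])
qed

section \<open>Convolution evaluated at a point as a mean\<close>

lemma conv_add:
  assumes "f \<in> prob_densities" "\<phi> \<in> Linf" "\<psi> \<in> Linf"
  shows "conv f (\<lambda>x. \<phi> x + \<psi> x) x = conv f \<phi> x + conv f \<psi> x"
  using integrable_conv_Linf[OF assms(1,2)] integrable_conv_Linf[OF assms(1,3)]
  by (simp add: conv_def distrib_right)

lemma conv_cmult: "conv f (\<lambda>x. c * \<phi> x) x = c * conv f \<phi> x"
  by (simp add: conv_def mult.assoc)

lemma conv_one: "f \<in> prob_densities \<Longrightarrow> conv f (\<lambda>x. 1) x = 1"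
  by (simp add: conv_def prob_densities_def)

lemma conv_nonneg_Reals:
  assumes "f \<in> prob_densities" "AE x in lebesgue. \<phi> x \<in> \<real>\<^sub>\<ge>\<^sub>0" "\<phi> \<in> Linf"
  shows "conv f \<phi> x \<in> \<real>\<^sub>\<ge>\<^sub>0"
proof -
  have pos: "AE t in lebesgue. \<phi> (x - t) * of_real (f t) \<in> \<real>\<^sub>\<ge>\<^sub>0"
    using assms(1) AE_lebesgue_reflect[OF assms(2), of x]
    by (auto simp: prob_densities_def intro: nonneg_Reals_mult_I)
  note i = integrable_conv_Linf[OF assms(1,3), of x]
  have "Re (conv f \<phi> x) = (LINT t|lebesgue. Re (\<phi> (x - t) * of_real (f t)))"
    and "Im (conv f \<phi> x) = (LINT t|lebesgue. Im (\<phi> (x - t) * of_real (f t)))"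
    unfolding conv_def using integral_bounded_linear[OF bounded_linear_Re i]
      integral_bounded_linear[OF bounded_linear_Im i] by simp_all
  moreover have "(LINT t|lebesgue. Re (\<phi> (x - t) * of_real (f t))) \<ge> 0"
    using pos by (intro integral_nonneg_AE) (auto simp: complex_nonneg_Reals_iff)
  moreover have "(LINT t|lebesgue. Im (\<phi> (x - t) * of_real (f t))) = 0"
    using pos by (intro integral_eq_zero_AE) (auto simp: complex_nonneg_Reals_iff)
  ultimately show ?thesis by (simp add: complex_nonneg_Reals_iff)
qed

section \<open>Limits of convolution means\<close>

lemma Linf_add:
  assumes "\<phi> \<in> Linf" "\<psi> \<in> Linf"
  shows "(\<lambda>x. \<phi> x + \<psi> x) \<in> Linf"
proof -
  obtain \<phi>' M where 1: "\<And>x. norm (\<phi>' x) \<le> M" "AE x in lebesgue. \<phi> x = \<phi>' x"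
    using Linf_borel_representative[OF assms(1)] by metis
  obtain \<psi>' N where 2: "\<And>x. norm (\<psi>' x) \<le> N" "AE x in lebesgue. \<psi> x = \<psi>' x"
    using Linf_borel_representative[OF assms(2)] by metis
  show ?thesis
  proof (rule LinfI)
    show "(\<lambda>x. \<phi> x + \<psi> x) \<in> borel_measurable lebesgue"
      using assms by (auto simp: Linf_def)
    show "AE x in lebesgue. norm (\<phi> x + \<psi> x) \<le> M + N"
      using 1(2) 2(2) by eventually_elim (auto intro!: norm_triangle_mono 1(1) 2(1))
  qed
qed

lemma Linf_cmult:
  assumes "\<phi> \<in> Linf"
  shows "(\<lambda>x. c * \<phi> x) \<in> Linf"
proof -
  obtain \<phi>' M where 1: "\<And>x. norm (\<phi>' x) \<le> M" "AE x in lebesgue. \<phi> x = \<phi>' x"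
    using Linf_borel_representative[OF assms] by metis
  show ?thesis
  proof (rule LinfI)
    show "(\<lambda>x. c * \<phi> x) \<in> borel_measurable lebesgue"
      using assms by (auto simp: Linf_def)
    show "AE x in lebesgue. norm (c * \<phi> x) \<le> norm c * M"
      using 1(2) by eventually_elim (auto simp: norm_mult intro!: mult_left_mono 1(1))
  qed
qed

lemma Linf_const: "(\<lambda>x. c) \<in> Linf"
  by (rule LinfI[of _ "norm c"]) auto

lemma Linf_diff_const: "\<phi> \<in> Linf \<Longrightarrow> (\<lambda>x. \<phi> x - c) \<in> Linf"
  using Linf_add[OF _ Linf_const, of \<phi> "- c"] by simp

text \<open>Tychonoff's theorem: eventually the functionals lie in a product of closed discs, which
  is compact for pointwise convergence. The neighbourhood filter of a cluster point \<Phi>,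
  intersected with the image filter, is a proper filter along which all coordinates converge; it
  plays the role of a convergent subnet.\<close>

lemma pointwise_cluster_point:
  fixes \<Psi> :: "'a \<Rightarrow> 'b \<Rightarrow> complex" and B :: "'b \<Rightarrow> real"
  assumes "F \<noteq> bot" and bound: "\<forall>\<^sub>F r in F. \<forall>\<psi>. norm (\<Psi> r \<psi>) \<le> B \<psi>"
  obtains \<Phi> G where "G \<noteq> bot" "G \<le> filtermap \<Psi> F" "\<And>\<psi>. ((\<lambda>\<Theta>. \<Theta> \<psi>) \<longlongrightarrow> \<Phi> \<psi>) G"
proof -
  let ?K = "PiE UNIV (\<lambda>\<psi>. cball (0 :: complex) (B \<psi>))"
  have "compactin (product_topology (\<lambda>_. euclidean) UNIV) ?K"
    by (simp add: compactin_PiE)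
  then have "compact ?K" by (simp add: euclidean_product_topology)
  moreover have "filtermap \<Psi> F \<noteq> bot" using assms(1) by (simp add: filtermap_bot_iff)
  moreover have "\<forall>\<^sub>F \<Theta> in filtermap \<Psi> F. \<Theta> \<in> ?K"
    using bound by (simp add: eventually_filtermap PiE_def Pi_def)
  ultimately obtain \<Phi> where "inf (nhds \<Phi>) (filtermap \<Psi> F) \<noteq> bot"
    unfolding compact_filter by blast
  moreover have "((\<lambda>\<Theta>. \<Theta> \<psi>) \<longlongrightarrow> \<Phi> \<psi>) (inf (nhds \<Phi>) (filtermap \<Psi> F))" for \<psi>
  proof -
    have "continuous_on UNIV (\<lambda>\<Theta> :: 'b \<Rightarrow> complex. \<Theta> \<psi>)" by (rule continuous_on_product_coordinates)
    moreover have "((\<lambda>\<Theta>. \<Theta>) \<longlongrightarrow> \<Phi>) (inf (nhds \<Phi>) (filtermap \<Psi> F))"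
      by (rule tendsto_mono[OF inf_le1 filterlim_ident])
    ultimately show ?thesis by (rule continuous_on_tendsto_compose) simp_all
  qed
  ultimately show thesis by (rule that[OF _ inf_le2])
qed

text \<open>The points \<open>y r\<close> may be arbitrary because asymptotic invariance is uniform
  in the point. The second conclusion passes closed conditions to the limit; inside the proof it
  yields the norm bound, positivity and normalization, and later it keeps \<Phi> \<phi> away from
  \<alpha>.\<close>

lemma topologically_invariant_cluster_point:
  fixes F :: "real filter" and y :: "real \<Rightarrow> real"
  assumes f: "f \<in> prob_densities" and F: "F \<noteq> bot" "F \<le> at_top"
  obtains \<Phi> where "\<Phi> \<in> topologically_invariant_means"
    and "\<And>\<psi> S. \<psi> \<in> Linf \<Longrightarrow> closed S \<Longrightarrow> \<forall>\<^sub>F r in F. conv (dilate r f) \<psi> (y r) \<in> S \<Longrightarrow> \<Phi> \<psi> \<in> S"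
proof -
  \<comment> \<open>Compactness needs a bound at every argument, including functions outside
    \<open>Linf\<close>; the value 0 there, matched by \<open>B\<close>, provides it.\<close>
  define \<Psi> where "\<Psi> r \<psi> = (if \<psi> \<in> Linf then conv (dilate r f) \<psi> (y r) else 0)" for r \<psi>
  have \<Psi>: "\<Psi> r \<psi> = conv (dilate r f) \<psi> (y r)" if "\<psi> \<in> Linf" for r \<psi>
    using that by (simp add: \<Psi>_def)
  define B where "B \<psi> = (if \<psi> \<in> Linf then real_of_ereal (Linf_norm \<psi>) else 0)" for \<psi>
  have pos: "\<forall>\<^sub>F r in F. r > 0" using F(2) eventually_gt_at_top by (rule filter_leD)
  have Linf_norm_B: "Linf_norm \<psi> = ereal (B \<psi>)" if "\<psi> \<in> Linf" for \<psi>
    using that by (auto simp: B_def elim!: Linf_borel_representative)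
  have norm_le: "norm (\<Psi> r \<psi>) \<le> B \<psi>" if "r > 0" for r \<psi>
  proof (cases "\<psi> \<in> Linf")
    case True
    then show ?thesis
      using norm_conv_le_Linf_norm[OF dilate_prob_densities[OF f that] True, of "y r"]
      by (simp add: \<Psi> Linf_norm_B)
  qed (simp add: \<Psi>_def B_def)
  have "\<forall>\<^sub>F r in F. \<forall>\<psi>. norm (\<Psi> r \<psi>) \<le> B \<psi>"
    using pos by eventually_elim (simp add: norm_le)
  from pointwise_cluster_point[OF F(1) this]
  obtain \<Phi> G where G: "G \<noteq> bot" "G \<le> filtermap \<Psi> F"
    and lim[tendsto_intros]: "\<And>\<psi>. ((\<lambda>\<Theta>. \<Theta> \<psi>) \<longlongrightarrow> \<Phi> \<psi>) G"
    by metis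
  \<comment> \<open>Identities for \<Phi> are obtained by applying this to the difference of their
    two sides: the difference tends to 0 along \<open>F\<close>, hence along the finer
    \<open>G\<close>, where limits are unique.\<close>
  have lim_zero: "l = 0" if "(h \<longlongrightarrow> l) G" "((\<lambda>r. h (\<Psi> r)) \<longlongrightarrow> 0) F" for h and l :: complex
  proof -
    have "(h \<longlongrightarrow> 0) (filtermap \<Psi> F)" using that(2) by (simp add: filterlim_filtermap)
    then have "(h \<longlongrightarrow> 0) G" by (rule tendsto_mono[OF G(2)])
    then show "l = 0" using tendsto_unique[OF G(1) that(1)] by simp
  qed
  have lim_closed: "\<Phi> \<psi> \<in> S" if "\<psi> \<in> Linf" "closed S" "\<forall>\<^sub>F r in F. conv (dilate r f) \<psi> (y r) \<in> S" for \<psi> S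
  proof (rule Lim_in_closed_set[OF that(2) _ G(1) lim])
    have "\<forall>\<^sub>F \<Theta> in filtermap \<Psi> F. \<Theta> \<psi> \<in> S"
      using that(1,3) by (simp add: eventually_filtermap \<Psi>)
    then show "\<forall>\<^sub>F \<Theta> in G. \<Theta> \<psi> \<in> S" by (rule filter_leD[OF G(2)])
  qed
  note dens = dilate_prob_densities[OF f]
  have add: "\<Phi> (\<lambda>x. \<phi> x + \<psi> x) = \<Phi> \<phi> + \<Phi> \<psi>" if "\<phi> \<in> Linf" "\<psi> \<in> Linf" for \<phi> \<psi>
  proof -
    have "\<forall>\<^sub>F r in F. \<Psi> r (\<lambda>x. \<phi> x + \<psi> x) - (\<Psi> r \<phi> + \<Psi> r \<psi>) = 0"
      using pos by eventually_elim (simp add: \<Psi> that Linf_add conv_add dens)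
    then have "\<Phi> (\<lambda>x. \<phi> x + \<psi> x) - (\<Phi> \<phi> + \<Phi> \<psi>) = 0"
      by (intro lim_zero[of "\<lambda>\<Theta>. \<Theta> (\<lambda>x. \<phi> x + \<psi> x) - (\<Theta> \<phi> + \<Theta> \<psi>)"] tendsto_intros)
        (auto intro: tendsto_eventually)
    then show ?thesis by simp
  qed
  have cmult: "\<Phi> (\<lambda>x. c * \<phi> x) = c * \<Phi> \<phi>" if "\<phi> \<in> Linf" for c \<phi>
  proof -
    have "(\<lambda>r. \<Psi> r (\<lambda>x. c * \<phi> x) - c * \<Psi> r \<phi>) = (\<lambda>r. 0)"
      by (simp add: \<Psi> that Linf_cmult conv_cmult)
    then have "\<Phi> (\<lambda>x. c * \<phi> x) - c * \<Phi> \<phi> = 0"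
      by (intro lim_zero[of "\<lambda>\<Theta>. \<Theta> (\<lambda>x. c * \<phi> x) - c * \<Theta> \<phi>"] tendsto_intros) simp
    then show ?thesis by simp
  qed
  have "norm (\<Phi> \<phi>) \<le> B \<phi>" if "\<phi> \<in> Linf" for \<phi>
  proof -
    have "\<forall>\<^sub>F r in F. conv (dilate r f) \<phi> (y r) \<in> cball 0 (B \<phi>)"
      using pos by eventually_elim (use norm_le[of _ \<phi>] that in \<open>simp add: \<Psi>\<close>)
    then show ?thesis using lim_closed[OF that closed_cball] by fastforce
  qed
  then have dual: "\<Phi> \<in> Linf_dual"
    unfolding Linf_dual_def using add cmult
    by (auto simp: Linf_norm_B intro!: exI[of _ 1])
  have nonneg: "\<Phi> \<phi> \<in> \<real>\<^sub>\<ge>\<^sub>0" if "\<phi> \<in> Linf" "AE x in lebesgue. \<phi> x \<in> \<real>\<^sub>\<ge>\<^sub>0" for \<phi>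
    using pos by (intro lim_closed that closed_nonneg_Reals_complex, eventually_elim)
      (simp add: conv_nonneg_Reals dens that)
  have "\<forall>\<^sub>F r in F. conv (dilate r f) (\<lambda>x. 1) (y r) \<in> {1}"
    using pos by eventually_elim (simp add: conv_one dens)
  then have "\<Phi> (\<lambda>x. 1) = 1" using lim_closed[OF Linf_const, of "{1}"] by blast
  then have mean: "is_mean \<Phi>" using dual nonneg by (simp add: is_mean_def)
  have "\<Phi> (conv g \<phi>) = \<Phi> \<phi>" if g: "g \<in> prob_densities" and \<phi>: "\<phi> \<in> Linf" for g \<phi>
  proof -
    obtain f' where f': "f' \<in> borel_measurable borel" "integrable lborel f'" "AE x in lebesgue. f x = f' x"
      using prob_densities_borel_representative[OF f] by metis
    obtain g' where g': "g' \<in> borel_measurable borel" "integrable lborel g'" "\<And>x. g' x \<ge> 0"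
        "(LINT x|lborel. g' x) = 1" "AE x in lebesgue. g x = g' x"
      using prob_densities_borel_representative[OF g] by metis
    obtain \<psi> M where \<psi>: "\<psi> \<in> borel_measurable borel" "\<And>x. norm (\<psi> x) \<le> M" "AE x in lebesgue. \<phi> x = \<psi> x"
      using Linf_borel_representative[OF \<phi>] by metis
    have conv_g: "conv g \<phi> = conv g' \<psi>" by (rule conv_representatives[OF g \<phi> g'(1,5) \<psi>(1,3)])
    \<comment> \<open>The estimate concerns Borel representatives; since convolutions of
      representatives agree at every point, it carries over to \<open>f\<close>, \<open>g\<close>
      and \<phi> themselves. As \<open>F\<close> is finer than \<open>at_top\<close>, \<delta> tends
      to 0 along \<open>F\<close> as well.\<close>
    obtain \<delta> where \<delta>: "(\<delta> \<longlongrightarrow> 0) at_top"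
      "\<And>r x. r > 0 \<Longrightarrow> norm (conv (dilate r f') (conv g' \<psi>) x - conv (dilate r f') \<psi> x) \<le> \<delta> r"
      using conv_dilate_asymptotically_invariant[OF f'(2) g'(2-4) \<psi>(1,2)] by metis
    have "\<forall>\<^sub>F r in F. norm (\<Psi> r (conv g \<phi>) - \<Psi> r \<phi>) \<le> \<delta> r"
      using pos
    proof eventually_elim
      case (elim r)
      have ae: "AE x in lebesgue. dilate r f x = dilate r f' x"
        using AE_lebesgue_affine[OF f'(3), of "1 / r" 0] elim by (auto simp: dilate_def)
      have m: "dilate r f' \<in> borel_measurable borel"
        using f'(1) unfolding dilate_def[abs_def] by measurable
      have "conv (dilate r f) \<phi> = conv (dilate r f') \<psi>"
        by (rule conv_representatives[OF dens[OF elim] \<phi> m ae \<psi>(1,3)])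
      moreover have "conv (dilate r f) (conv g \<phi>) = conv (dilate r f') (conv g' \<psi>)"
        by (rule conv_representatives[OF dens[OF elim] conv_Linf[OF g \<phi>] m ae conv_measurable[OF g'(1) \<psi>(1)]])
          (simp add: conv_g)
      ultimately show ?case using \<delta>(2)[OF elim] by (simp add: \<Psi> \<phi> conv_Linf[OF g \<phi>])
    qed
    then have "((\<lambda>r. \<Psi> r (conv g \<phi>) - \<Psi> r \<phi>) \<longlongrightarrow> 0) F"
      by (rule Lim_null_comparison) (rule tendsto_mono[OF F(2) \<delta>(1)])
    then have "\<Phi> (conv g \<phi>) - \<Phi> \<phi> = 0"
      by (intro lim_zero[of "\<lambda>\<Theta>. \<Theta> (conv g \<phi>) - \<Theta> \<phi>"] tendsto_intros)
    then show ?thesis by simp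
  qed
  then have "\<Phi> \<in> topologically_invariant_means"
    using mean by (simp add: topologically_invariant_means_def)
  then show thesis using lim_closed by (rule that)
qed

section \<open>Almost convergence, uniform convergence and norm convergence\<close>

lemma almost_convergent_imp_uniform_limit:
  assumes f: "f \<in> prob_densities" and \<phi>: "\<phi> \<in> Linf" and ac: "almost_convergent \<phi> \<alpha>"
  shows "uniform_limit UNIV (\<lambda>r. conv (dilate r f) \<phi>) (\<lambda>x. \<alpha>) at_top"
proof (rule ccontr)
  assume "\<not> ?thesis"
  then obtain e where "e > 0" and e: "\<not> (\<forall>\<^sub>F r in at_top. \<forall>x. dist (conv (dilate r f) \<phi> x) \<alpha> < e)"
    by (auto simp: uniform_limit_iff)
  define A where "A = {r. \<exists>x. e \<le> dist (conv (dilate r f) \<phi> x) \<alpha>}"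
  define y where "y r = (SOME x. e \<le> dist (conv (dilate r f) \<phi> x) \<alpha>)" for r
  \<comment> \<open>Only the bad scales in \<open>A\<close> are kept. This filter is proper
    precisely because the uniform estimate with \<open>e\<close> does not hold eventually.\<close>
  define F where "F = inf at_top (principal A)"
  have y: "e \<le> dist (conv (dilate r f) \<phi> (y r)) \<alpha>" if "r \<in> A" for r
    using that unfolding A_def y_def by (auto intro: someI_ex)
  have "F \<noteq> bot"
    using e unfolding trivial_limit_def F_def eventually_inf_principal A_def by (simp add: not_le)
  moreover have "F \<le> at_top" by (simp add: F_def)
  ultimately obtain \<Phi> where \<Phi>: "\<Phi> \<in> topologically_invariant_means"
    and cl: "\<And>\<psi> S. \<psi> \<in> Linf \<Longrightarrow> closed S \<Longrightarrow> \<forall>\<^sub>F r in F. conv (dilate r f) \<psi> (y r) \<in> S \<Longrightarrow> \<Phi> \<psi> \<in> S"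
    using topologically_invariant_cluster_point[OF f, of F y] by metis
  \<comment> \<open>Staying at distance at least \<open>e\<close> from \<alpha> is a closed
    condition, so it survives in the limit and contradicts \<Phi> \<phi> = \<alpha>.\<close>
  have "closed {z. e \<le> dist z \<alpha>}" by (intro closed_Collect_le continuous_intros)
  moreover have "\<forall>\<^sub>F r in F. conv (dilate r f) \<phi> (y r) \<in> {z. e \<le> dist z \<alpha>}"
    using y by (simp add: F_def eventually_inf_principal)
  ultimately have "\<Phi> \<phi> \<in> {z. e \<le> dist z \<alpha>}" by (rule cl[OF \<phi>])
  moreover have "\<Phi> \<phi> = \<alpha>" using ac \<Phi> by (simp add: almost_convergent_def)
  ultimately show False using \<open>e > 0\<close> by simp
qed

lemma uniform_limit_imp_Linf_norm_tendsto:
  assumes f: "f \<in> prob_densities" and \<phi>: "\<phi> \<in> Linf"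
    and lim: "uniform_limit UNIV (\<lambda>r. conv (dilate r f) \<phi>) (\<lambda>x. \<alpha>) at_top"
  shows "((\<lambda>r. Linf_norm (\<lambda>x. conv (dilate r f) \<phi> x - \<alpha>)) \<longlongrightarrow> 0) at_top"
proof (rule order_tendstoI)
  fix a :: ereal assume "a < 0"
  then show "\<forall>\<^sub>F r in at_top. a < Linf_norm (\<lambda>x. conv (dilate r f) \<phi> x - \<alpha>)"
    using Linf_norm_nonneg less_le_trans by (intro always_eventually allI) blast
next
  fix a :: ereal assume "0 < a"
  \<comment> \<open>A real \<open>e\<close> strictly below \<open>a\<close>, which may be infinite,
    restores the strict inequality lost when a pointwise bound passes to the essential
    supremum.\<close>
  then obtain e where e: "0 < ereal e" "ereal e < a" using ereal_dense2 by blast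
  from lim e(1) have "\<forall>\<^sub>F r in at_top. \<forall>x. dist (conv (dilate r f) \<phi> x) \<alpha> < e"
    by (simp add: uniform_limit_iff)
  then show "\<forall>\<^sub>F r in at_top. Linf_norm (\<lambda>x. conv (dilate r f) \<phi> x - \<alpha>) < a"
    using eventually_gt_at_top[of 0]
  proof eventually_elim
    case (elim r)
    have "(\<lambda>x. conv (dilate r f) \<phi> x - \<alpha>) \<in> Linf"
      by (intro Linf_diff_const conv_Linf dilate_prob_densities f \<phi> elim)
    then have "Linf_norm (\<lambda>x. conv (dilate r f) \<phi> x - \<alpha>) \<le> ereal e"
      using elim by (intro Linf_norm_le) (auto simp: Linf_def dist_norm less_imp_le)
    then show ?case using e(2) by (rule le_less_trans)
  qed
qed

text \<open>By invariance, linearity and normalization, an invariant mean sends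
  \<open>conv (dilate r f) \<phi>\<close> minus \<alpha> to the same number \<Phi> \<phi> - \<alpha>
  for all r > 0. Boundedness makes this number arbitrarily small.\<close>

lemma Linf_norm_tendsto_imp_almost_convergent:
  assumes f: "f \<in> prob_densities" and \<phi>: "\<phi> \<in> Linf"
    and lim: "((\<lambda>r. Linf_norm (\<lambda>x. conv (dilate r f) \<phi> x - \<alpha>)) \<longlongrightarrow> 0) at_top"
  shows "almost_convergent \<phi> \<alpha>"
  unfolding almost_convergent_def
proof
  fix \<Phi> assume \<Phi>: "\<Phi> \<in> topologically_invariant_means"
  then have add: "\<And>\<phi> \<psi>. \<phi> \<in> Linf \<Longrightarrow> \<psi> \<in> Linf \<Longrightarrow> \<Phi> (\<lambda>x. \<phi> x + \<psi> x) = \<Phi> \<phi> + \<Phi> \<psi>"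
    and cmult: "\<And>c \<phi>. \<phi> \<in> Linf \<Longrightarrow> \<Phi> (\<lambda>x. c * \<phi> x) = c * \<Phi> \<phi>"
    and one: "\<Phi> (\<lambda>x. 1) = 1"
    and inv: "\<And>g \<phi>. g \<in> prob_densities \<Longrightarrow> \<phi> \<in> Linf \<Longrightarrow> \<Phi> (conv g \<phi>) = \<Phi> \<phi>"
    and "\<exists>C. \<forall>\<phi>\<in>Linf. ereal (norm (\<Phi> \<phi>)) \<le> ereal C * Linf_norm \<phi>"
    unfolding topologically_invariant_means_def is_mean_def Linf_dual_def by blast+
  then obtain C where C: "\<And>\<phi>. \<phi> \<in> Linf \<Longrightarrow> ereal (norm (\<Phi> \<phi>)) \<le> ereal C * Linf_norm \<phi>" by blast
  show "\<Phi> \<phi> = \<alpha>"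
  proof (rule ccontr)
    define d where "d = norm (\<Phi> \<phi> - \<alpha>)"
    assume "\<Phi> \<phi> \<noteq> \<alpha>"
    then have "d > 0" by (simp add: d_def)
    \<comment> \<open>The constant \<open>C\<close> may be zero or negative;
      \<open>\<bar>C\<bar> + 1\<close> is a positive replacement.\<close>
    then have "0 < ereal (d / (\<bar>C\<bar> + 1))" by (simp add: add_nonneg_pos)
    from eventually_conj[OF order_tendstoD(2)[OF lim this] eventually_gt_at_top[of 0]]
    obtain r where small: "Linf_norm (\<lambda>x. conv (dilate r f) \<phi> x - \<alpha>) < ereal (d / (\<bar>C\<bar> + 1))" and "r > 0"
      by (auto dest!: eventually_happens simp: trivial_limit_at_top_linorder)
    let ?\<psi> = "\<lambda>x. conv (dilate r f) \<phi> x - \<alpha>"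
    note r = dilate_prob_densities[OF f \<open>r > 0\<close>]
    have \<psi>: "?\<psi> \<in> Linf" by (intro Linf_diff_const conv_Linf r \<phi>)
    obtain M where M: "Linf_norm ?\<psi> = ereal M" using Linf_borel_representative[OF \<psi>] by metis
    have "\<Phi> ?\<psi> = \<Phi> (conv (dilate r f) \<phi>) + \<Phi> (\<lambda>x. (- \<alpha>) * 1)"
      using add[OF conv_Linf[OF r \<phi>] Linf_const[of "- \<alpha>"]] by simp
    also have "\<dots> = \<Phi> \<phi> - \<alpha>"
      using cmult[OF Linf_const, of "- \<alpha>" 1] by (simp add: one inv[OF r \<phi>])
    finally have "d \<le> C * M" using C[OF \<psi>] by (simp add: d_def M)
    also have "\<dots> \<le> \<bar>C\<bar> * M"
      using Linf_norm_nonneg[of ?\<psi>] by (simp add: M mult_right_mono)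
    also have "\<dots> \<le> (\<bar>C\<bar> + 1) * M"
      using Linf_norm_nonneg[of ?\<psi>] by (simp add: M distrib_right)
    also have "\<dots> < d" using small by (simp add: M field_simps add_nonneg_pos)
    finally show False by simp
  qed
qed

text \<open>The three implications form a cycle from almost convergence through uniform convergence
  and norm convergence back to almost convergence, which gives both equivalences.\<close>

theorem theorem3p5:
  fixes f :: "real \<Rightarrow> real" and \<phi> :: "real \<Rightarrow> complex" and \<alpha> :: complex
  assumes "f \<in> prob_densities" and "\<phi> \<in> Linf"
  shows "(almost_convergent \<phi> \<alpha> \<longleftrightarrow>
            uniform_limit UNIV (\<lambda>r. conv (dilate r f) \<phi>) (\<lambda>x. \<alpha>) at_top) \<and>
         (almost_convergent \<phi> \<alpha> \<longleftrightarrow>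
            ((\<lambda>r. Linf_norm (\<lambda>x. conv (dilate r f) \<phi> x - \<alpha>)) \<longlongrightarrow> 0) at_top)"
  using almost_convergent_imp_uniform_limit[OF assms] uniform_limit_imp_Linf_norm_tendsto[OF assms]
    Linf_norm_tendsto_imp_almost_convergent[OF assms]
  by blast

end
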